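(* Let $\Bbbk$ be an algebraically closed field of characteristic zero and let $D$ be a nonzero $\Bbbk$-derivation of $\Bbbk[x,y]$. Then $D$ admits an eigenvector with null eigenvalue which is equivalent to an element in $\Bbbk[x]$ if and only if $D$ is conjugate to $b\,\partial_y$ for some $b\in\Bbbk[x,y]\setminus\{0\}$. Moreover, in that case we have: a) If $b\in\Bbbk[x]$, then $D$ is locally nilpotent and $\operatorname{Aut}(D)$ is not an algebraic group. b) If $\deg_y b\geq 1$, then $\operatorname{Aut}(D)$ is an algebraic group.
   Context: $\operatorname{Aut}_\Bbbk(\Bbbk[x,y])$ is the group of $\Bbbk$-algebra automorphisms of $\Bbbk[x,y]$. For a $\Bbbk$-derivation $D$ of $\Bbbk[x,y]$, $\operatorname{Aut}(D)=\{\rho\in\operatorname{Aut}_\Bbbk(\Bbbk[x,y]) : \rho D=D\rho\}$. Two derivations $D,D'$ are conjugate if $D'=\varphi D\varphi^{-1}$ for some $\varphi\in\operatorname{Aut}_\Bbbk(\Bbbk[x,y])$. An eigenvector of $D$ is a polynomial $f\in\Bbbk[x,y]\setminus\Bbbk$ such that $D(f)=\lambda f$ for some $\lambda\in\Bbbk[x,y]$; $\lambda$ is its eigenvalue. A polynomial $f$ is equivalent to $g$ if there is $\varphi\in\operatorname{Aut}_\Bbbk(\Bbbk[x,y])$ with $\varphi(g)=f$. $D$ is locally nilpotent if for any $f\in\Bbbk[x,y]$ there is a positive integer $n$ with $D^n(f)=0$. The degree of $\rho\in\operatorname{Aut}_\Bbbk(\Bbbk[x,y])$ is $\max\{\deg\rho(x),\deg\rho(y)\}$.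 The set $\operatorname{Aut}(\Bbbk[x,y])_d$ of automorphisms of degree $\le d$ is an affine algebraic variety (structure given by the coefficients of $\rho(x),\rho(y)$), closed in $\operatorname{Aut}(\Bbbk[x,y])_{d+1}$; $\operatorname{Aut}_\Bbbk(\Bbbk[x,y])=\bigcup_d\operatorname{Aut}(\Bbbk[x,y])_d$ carries the inductive topology. A subgroup of $\operatorname{Aut}_\Bbbk(\Bbbk[x,y])$ is an algebraic group iff it is closed and contained in $\operatorname{Aut}(\Bbbk[x,y])_d$ for some $d$. *)

theory Defs
  imports
    "HOL-Computational_Algebra.Polynomial"
    "HOL-Algebra.Group"
    "HOL-Analysis.Abstract_Topology"
begin

section \<open>The polynomial ring in two variables\<close>

text \<open>
  The ring k[x,y] is k[x][y], the type \<open>'a poly poly\<close> for a field \<open>'a\<close>: the inner variable is x,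
  the outer one is y. Hence \<open>coeff (coeff f j) i\<close> is the coefficient of \<open>x^i y^j\<close> in \<open>f\<close>,
  \<open>degree f\<close> is the degree in y, and \<open>pderiv f\<close> is the partial derivative with respect to y.
\<close>

definition scalar :: "'a::field \<Rightarrow> 'a poly poly" where
  "scalar c = [:[:c:]:]"

definition var_x :: "'a::field poly poly" where
  "var_x = [:[:0, 1:]:]"

definition var_y :: "'a::field poly poly" where
  "var_y = [:0, 1:]"

definition polys_in_x :: "'a::field poly poly set" where
  "polys_in_x = range (\<lambda>p. [:p:])"

definition total_degree :: "'a::field poly poly \<Rightarrow> nat" where
  "total_degree f = (if f = 0 then 0 else Max {i + j |i j. coeff (coeff f j) i \<noteq> 0})"


section \<open>Derivations and automorphisms\<close>

definition derivation :: "('a::field poly poly \<Rightarrow> 'a poly poly) \<Rightarrow> bool" where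
  "derivation D \<longleftrightarrow>
     (\<forall>f g. D (f + g) = D f + D g) \<and>
     (\<forall>c f. D (scalar c * f) = scalar c * D f) \<and>
     (\<forall>f g. D (f * g) = D f * g + f * D g)"

definition locally_nilpotent :: "('a::field poly poly \<Rightarrow> 'a poly poly) \<Rightarrow> bool" where
  "locally_nilpotent D \<longleftrightarrow> (\<forall>f. \<exists>n>0. (D ^^ n) f = 0)"

definition eigenvector ::
    "('a::field poly poly \<Rightarrow> 'a poly poly) \<Rightarrow> 'a poly poly \<Rightarrow> 'a poly poly \<Rightarrow> bool" where
  "eigenvector D f l \<longleftrightarrow> f \<notin> range scalar \<and> D f = l * f"

definition automorphisms :: "('a::field poly poly \<Rightarrow> 'a poly poly) set" where
  "automorphisms = {\<rho>. bij \<rho> \<and>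
     (\<forall>f g. \<rho> (f + g) = \<rho> f + \<rho> g) \<and>
     (\<forall>f g. \<rho> (f * g) = \<rho> f * \<rho> g) \<and>
     (\<forall>c. \<rho> (scalar c) = scalar c)}"

definition automorphism_group :: "('a::field poly poly \<Rightarrow> 'a poly poly) monoid" where
  "automorphism_group = \<lparr>carrier = automorphisms, mult = (\<circ>), one = id\<rparr>"

definition equivalent_polys :: "'a::field poly poly \<Rightarrow> 'a poly poly \<Rightarrow> bool" where
  "equivalent_polys f g \<longleftrightarrow> (\<exists>\<phi>\<in>automorphisms. \<phi> g = f)"

definition conjugate ::
    "('a::field poly poly \<Rightarrow> 'a poly poly) \<Rightarrow> ('a poly poly \<Rightarrow> 'a poly poly) \<Rightarrow> bool" where
  "conjugate D D' \<longleftrightarrow> (\<exists>\<phi>\<in>automorphisms. D' = \<phi> \<circ> D \<circ> inv_into UNIV \<phi>)"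

definition isotropy ::
    "('a::field poly poly \<Rightarrow> 'a poly poly) \<Rightarrow> ('a poly poly \<Rightarrow> 'a poly poly) set" where
  "isotropy D = {\<rho>\<in>automorphisms. \<rho> \<circ> D = D \<circ> \<rho>}"

lemma group_automorphism_group: "group (automorphism_group :: ('a::field poly poly \<Rightarrow> _) monoid)"
proof (rule groupI)
  fix \<rho> :: "'a poly poly \<Rightarrow> 'a poly poly"
  assume "\<rho> \<in> carrier automorphism_group"
  then have \<rho>: "bij \<rho>" "\<And>f g. \<rho> (f + g) = \<rho> f + \<rho> g" "\<And>f g. \<rho> (f * g) = \<rho> f * \<rho> g"
      "\<And>c. \<rho> (scalar c) = scalar c"
    by (auto simp: automorphism_group_def automorphisms_def)
  define \<sigma> where "\<sigma> = inv_into UNIV \<rho>"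
  have \<sigma>: "\<sigma> (\<rho> f) = f" "\<rho> (\<sigma> f) = f" for f
    using \<rho>(1) by (simp_all add: \<sigma>_def bij_is_inj bij_is_surj surj_f_inv_f)
  have "\<sigma> f = h \<longleftrightarrow> f = \<rho> h" for f h
    using \<sigma> by metis
  then have "\<sigma> \<in> automorphisms"
    using \<rho> \<sigma>(2) bij_imp_bij_inv[OF \<rho>(1)] by (auto simp: automorphisms_def \<sigma>_def[symmetric])
  then show "\<exists>\<tau>\<in>carrier automorphism_group. \<tau> \<otimes>\<^bsub>automorphism_group\<^esub> \<rho> = \<one>\<^bsub>automorphism_group\<^esub>"
    using \<sigma> by (auto simp: automorphism_group_def fun_eq_iff intro!: bexI[of _ \<sigma>])
qed (auto simp: automorphism_group_def automorphisms_def bij_comp o_assoc)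


section \<open>The ind-topology on the automorphism group and algebraic subgroups\<close>

definition aut_degree :: "('a::field poly poly \<Rightarrow> 'a poly poly) \<Rightarrow> nat" where
  "aut_degree \<rho> = max (total_degree (\<rho> var_x)) (total_degree (\<rho> var_y))"

definition automorphisms_upto :: "nat \<Rightarrow> ('a::field poly poly \<Rightarrow> 'a poly poly) set" where
  "automorphisms_upto d = {\<rho>\<in>automorphisms. aut_degree \<rho> \<le> d}"

text \<open>
  The polynomial functions in the coefficients, up to degree \<open>d\<close>, of the images of x and y.
\<close>

inductive_set coeff_functions :: "nat \<Rightarrow> (('a::field poly poly \<Rightarrow> 'a poly poly) \<Rightarrow> 'a) set"
  for d :: nat where
  const: "(\<lambda>_. c) \<in> coeff_functions d"
| coeff_x: "i + j \<le> d \<Longrightarrow> (\<lambda>\<rho>. coeff (coeff (\<rho> var_x) j) i) \<in> coeff_functions d"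
| coeff_y: "i + j \<le> d \<Longrightarrow> (\<lambda>\<rho>. coeff (coeff (\<rho> var_y) j) i) \<in> coeff_functions d"
| add: "p \<in> coeff_functions d \<Longrightarrow> q \<in> coeff_functions d \<Longrightarrow> (\<lambda>\<rho>. p \<rho> + q \<rho>) \<in> coeff_functions d"
| mult: "p \<in> coeff_functions d \<Longrightarrow> q \<in> coeff_functions d \<Longrightarrow> (\<lambda>\<rho>. p \<rho> * q \<rho>) \<in> coeff_functions d"

text \<open>
  The automorphisms of degree at most \<open>d\<close> form a locally closed subset of the affine space of
  coefficients: among the pairs of polynomials, the condition that the Jacobian determinant be a
  constant is closed, that it be nonzero is open, and being an automorphism is closed in what
  remains. The Zariski topology of this affine variety (in which also the inverse of the Jacobian
  determinant is a regular function) is therefore the subspace topology of the coefficient space.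
  Its closed sets are the common zero loci of sets of polynomial functions in the coefficients.
\<close>

definition zariski_topology :: "nat \<Rightarrow> ('a::field poly poly \<Rightarrow> 'a poly poly) topology" where
  "zariski_topology d =
     topology (\<lambda>U. \<exists>S\<subseteq>coeff_functions d. U = {\<rho>\<in>automorphisms_upto d. \<exists>p\<in>S. p \<rho> \<noteq> 0})"

definition ind_topology :: "('a::field poly poly \<Rightarrow> 'a poly poly) topology" where
  "ind_topology = topology (\<lambda>U. U \<subseteq> automorphisms \<and>
     (\<forall>d. openin (zariski_topology d) (U \<inter> automorphisms_upto d)))"

definition algebraic_subgroup :: "('a::field poly poly \<Rightarrow> 'a poly poly) set \<Rightarrow> bool" where
  "algebraic_subgroup G \<longleftrightarrow>
     subgroup G automorphism_group \<and> closedin ind_topology G \<and> (\<exists>d. G \<subseteq> automorphisms_upto d)"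

lemma openin_zariski_topology:
  "openin (zariski_topology d) U \<longleftrightarrow>
     (\<exists>S\<subseteq>coeff_functions d. U = {\<rho>\<in>automorphisms_upto d. \<exists>p\<in>S. p \<rho> \<noteq> 0})"
proof -
  define op where "op = (\<lambda>U :: ('a poly poly \<Rightarrow> 'a poly poly) set.
    \<exists>S\<subseteq>coeff_functions d. U = {\<rho>\<in>automorphisms_upto d. \<exists>p\<in>S. p \<rho> \<noteq> 0})"
  have "op (U \<inter> V)" if UV: "op U" "op V" for U V
  proof -
    from UV obtain S T where ST: "S \<subseteq> coeff_functions d" "T \<subseteq> coeff_functions d"
      "U = {\<rho>\<in>automorphisms_upto d. \<exists>p\<in>S. p \<rho> \<noteq> 0}"
      "V = {\<rho>\<in>automorphisms_upto d. \<exists>p\<in>T. p \<rho> \<noteq> 0}"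
      unfolding op_def by blast
    let ?P = "(\<lambda>(p, q) \<rho>. p \<rho> * q \<rho>) ` (S \<times> T)"
    have "?P \<subseteq> coeff_functions d"
      using ST by (auto intro!: coeff_functions.mult)
    moreover have "U \<inter> V = {\<rho>\<in>automorphisms_upto d. \<exists>p\<in>?P. p \<rho> \<noteq> 0}"
      unfolding ST by fastforce
    ultimately show ?thesis
      unfolding op_def by blast
  qed
  moreover have "op (\<Union>\<K>)" if "\<forall>K\<in>\<K>. op K" for \<K>
  proof -
    define T where "T = {p\<in>coeff_functions d. \<exists>K\<in>\<K>. \<forall>\<rho>\<in>automorphisms_upto d. p \<rho> \<noteq> 0 \<longrightarrow> \<rho> \<in> K}"
    have "\<Union>\<K> = {\<rho>\<in>automorphisms_upto d. \<exists>p\<in>T. p \<rho> \<noteq> 0}"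
    proof (intro equalityI subsetI)
      fix \<rho> assume "\<rho> \<in> \<Union>\<K>"
      then obtain K where K: "K \<in> \<K>" "\<rho> \<in> K"
        by blast
      with that obtain S where S: "S \<subseteq> coeff_functions d"
          "K = {\<rho>\<in>automorphisms_upto d. \<exists>p\<in>S. p \<rho> \<noteq> 0}"
        unfolding op_def by meson
      with K(2) obtain p where "\<rho> \<in> automorphisms_upto d" "p \<in> S" "p \<rho> \<noteq> 0"
        by auto
      moreover from this have "p \<in> T"
        unfolding T_def using K(1) S by (intro CollectI conjI bexI[of _ K]) auto
      ultimately show "\<rho> \<in> {\<rho>\<in>automorphisms_upto d. \<exists>p\<in>T. p \<rho> \<noteq> 0}"
        by auto
    qed (auto simp: T_def)
    moreover have "T \<subseteq> coeff_functions d"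
      by (auto simp: T_def)
    ultimately show ?thesis
      unfolding op_def by (intro exI[of _ T]) simp
  qed
  ultimately have "istopology op"
    unfolding istopology_def by blast
  then show ?thesis
    unfolding zariski_topology_def op_def by simp
qed

lemma topspace_zariski_topology: "topspace (zariski_topology d) = automorphisms_upto d"
  (is "?T = ?A")
proof
  have "openin (zariski_topology d) ?T"
    by (rule openin_topspace)
  then obtain S where "S \<subseteq> coeff_functions d" "?T = {\<rho>\<in>?A. \<exists>p\<in>S. p \<rho> \<noteq> 0}"
    unfolding openin_zariski_topology by blast
  then show "?T \<subseteq> ?A"
    by auto
  have "openin (zariski_topology d) ?A"
    unfolding openin_zariski_topology
  proof (intro exI conjI)
    show "{\<lambda>_. 1} \<subseteq> coeff_functions d"
      by (intro insert_subsetI coeff_functions.const empty_subsetI)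
    show "?A = {\<rho>\<in>?A. \<exists>p\<in>{\<lambda>_. 1 :: 'a}. p \<rho> \<noteq> 0}"
      by simp
  qed
  then show "?A \<subseteq> ?T"
    by (rule openin_subset)
qed

lemma openin_ind_topology:
  "openin ind_topology U \<longleftrightarrow>
     U \<subseteq> automorphisms \<and> (\<forall>d. openin (zariski_topology d) (U \<inter> automorphisms_upto d))"
proof -
  define op where "op = (\<lambda>U :: ('a poly poly \<Rightarrow> 'a poly poly) set. U \<subseteq> automorphisms \<and>
    (\<forall>d. openin (zariski_topology d) (U \<inter> automorphisms_upto d)))"
  have "op (U \<inter> V)" if "op U" "op V" for U V
  proof -
    have "openin (zariski_topology d) (U \<inter> V \<inter> automorphisms_upto d)" for d
    proof -
      have eq: "U \<inter> V \<inter> automorphisms_upto d =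
          (U \<inter> automorphisms_upto d) \<inter> (V \<inter> automorphisms_upto d)"
        by blast
      show ?thesis
        unfolding eq by (rule openin_Int) (use that in \<open>simp_all add: op_def\<close>)
    qed
    then show ?thesis
      using that by (auto simp: op_def)
  qed
  moreover have "op (\<Union>\<K>)" if "\<forall>K\<in>\<K>. op K" for \<K>
  proof -
    have "openin (zariski_topology d) (\<Union>\<K> \<inter> automorphisms_upto d)" for d
    proof -
      have eq: "\<Union>\<K> \<inter> automorphisms_upto d = \<Union>((\<lambda>K. K \<inter> automorphisms_upto d) ` \<K>)"
        by blast
      show ?thesis
        unfolding eq using that by (intro openin_Union) (auto simp: op_def)
    qed
    then show ?thesis
      using that by (auto simp: op_def)
  qed
  ultimately have "istopology op"
    unfolding istopology_def by blast
  then show ?thesis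
    unfolding ind_topology_def op_def by simp
qed

lemma topspace_ind_topology: "topspace ind_topology = automorphisms" (is "?T = ?A")
proof
  show "?T \<subseteq> ?A"
    by (rule conjunct1[OF openin_ind_topology[THEN iffD1, OF openin_topspace]])
  have "?A \<inter> automorphisms_upto d = topspace (zariski_topology d)" for d
    by (auto simp: topspace_zariski_topology automorphisms_upto_def)
  then have "openin (zariski_topology d) (?A \<inter> automorphisms_upto d)" for d
    by (simp only: openin_topspace)
  then have "openin ind_topology ?A"
    by (simp add: openin_ind_topology)
  then show "?A \<subseteq> ?T"
    by (rule openin_subset)
qed

lemma closedin_zariski_topology:
  "closedin (zariski_topology d) Z \<longleftrightarrow>
     (\<exists>S\<subseteq>coeff_functions d. Z = {\<rho>\<in>automorphisms_upto d. \<forall>p\<in>S. p \<rho> = 0})"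
  unfolding closedin_def topspace_zariski_topology openin_zariski_topology
proof safe
  fix S assume "Z \<subseteq> automorphisms_upto d" "S \<subseteq> coeff_functions d"
    "automorphisms_upto d - Z = {\<rho>\<in>automorphisms_upto d. \<exists>p\<in>S. p \<rho> \<noteq> 0}"
  then show "\<exists>S\<subseteq>coeff_functions d. Z = {\<rho>\<in>automorphisms_upto d. \<forall>p\<in>S. p \<rho> = 0}"
    by (intro exI[of _ S]) blast
next
  fix S assume "S \<subseteq> (coeff_functions d :: (('a poly poly \<Rightarrow> 'a poly poly) \<Rightarrow> 'a) set)"
  then show "\<exists>T\<subseteq>coeff_functions d. automorphisms_upto d -
      {\<rho>\<in>automorphisms_upto d. \<forall>p\<in>S. p \<rho> = 0} = {\<rho>\<in>automorphisms_upto d. \<exists>p\<in>T. p \<rho> \<noteq> 0}"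
    by (intro exI[of _ S]) blast
qed

lemma closedin_ind_topology:
  "closedin ind_topology Z \<longleftrightarrow>
     Z \<subseteq> automorphisms \<and> (\<forall>d. closedin (zariski_topology d) (Z \<inter> automorphisms_upto d))"
proof -
  have "(automorphisms - Z) \<inter> automorphisms_upto d =
      automorphisms_upto d - Z \<inter> automorphisms_upto d" for d
    by (auto simp: automorphisms_upto_def)
  then show ?thesis
    by (simp add: closedin_def topspace_ind_topology topspace_zariski_topology openin_ind_topology)
qed

end

theory Submission
  imports Defs
begin

text \<open>
  If \<open>f = \<phi>(g)\<close> with \<open>g \<in> k[x]\<close> nonconstant and \<open>D f = 0\<close>, the conjugate of \<open>D\<close> by \<open>\<phi>\<close> kills
  \<open>g\<close>, hence kills \<open>x\<close> by the chain rule, and so it is a multiple of \<open>\<partial>\<^sub>y\<close>.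

  If \<open>b \<in> k[x]\<close>, all the automorphisms \<open>(x, y + x^n)\<close> commute with \<open>b \<partial>\<^sub>y\<close>, so degrees are
  unbounded. Let instead \<open>deg\<^sub>y b = m \<ge> 1\<close> and let \<open>\<rho>\<close> commute with \<open>b \<partial>\<^sub>y\<close>. Then \<open>\<rho>(x)\<close> is an
  affine polynomial in x. Cancelling \<open>b\<close> in the commutation relation gives
  \<open>\<partial>\<^sub>y(\<rho> f) = \<partial>\<^sub>y(\<rho> y) \<rho>(\<partial>\<^sub>y f)\<close>; taking \<open>f = \<rho>\<^sup>-\<^sup>1(y)\<close> shows that \<open>\<partial>\<^sub>y(\<rho> y)\<close> is a unit, so
  \<open>\<rho>(y) = c y + p(x)\<close>. Applying \<open>\<partial>\<^sub>y^(m - 1)\<close> to \<open>\<rho>(b) = c b\<close> leaves a relation between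
  polynomials \<open>u(x) y + v(x)\<close> of degree 1 in y, whose constant term forces \<open>deg p \<le> deg v\<close>.

  Commuting with \<open>D\<close> is a closed condition, since it amounts to polynomial equations in the
  coefficients of \<open>\<rho>(x)\<close> and \<open>\<rho>(y)\<close>; and conjugation preserves bounded degree.
\<close>

section \<open>Total degree and monomial expansion\<close>

text \<open>The support of a polynomial is finite, so \<open>Max\<close> in
  \<open>total_degree\<close> is a genuine maximum. Later degree bounds argue coefficient by
  coefficient through this criterion.\<close>

lemma total_degree_le_iff:
  "total_degree f \<le> n \<longleftrightarrow> (\<forall>i j. coeff (coeff f j) i \<noteq> 0 \<longrightarrow> i + j \<le> n)"
proof (cases "f = 0")
  case False
  let ?S = "{i + j |i j. coeff (coeff f j) i \<noteq> 0}"
  have "?S \<subseteq> (\<lambda>(j, i). i + j) ` (SIGMA j:{..degree f}. {..degree (coeff f j)})"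
  proof
    fix k assume "k \<in> ?S"
    then obtain i j where ij: "k = i + j" "coeff (coeff f j) i \<noteq> 0"
      by blast
    then have "coeff f j \<noteq> 0"
      by auto
    with ij show "k \<in> (\<lambda>(j, i). i + j) ` (SIGMA j:{..degree f}. {..degree (coeff f j)})"
      by (intro image_eqI[of _ _ "(j, i)"]) (auto simp: le_degree)
  qed
  then have "finite ?S"
    by (rule finite_subset) auto
  moreover from False have "?S \<noteq> {}"
    by (auto simp: poly_eq_iff)
  ultimately show ?thesis
    using False by (subst total_degree_def) auto
qed (simp add: total_degree_def)

lemma total_degree_add_le:
  "total_degree f \<le> n \<Longrightarrow> total_degree g \<le> n \<Longrightarrow> total_degree (f + g) \<le> n"
  unfolding total_degree_le_iff by (metis add.left_neutral coeff_add)

lemma total_degree_sum_le: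
  "(\<And>k. k \<in> A \<Longrightarrow> total_degree (f k) \<le> n) \<Longrightarrow> total_degree (\<Sum>k\<in>A. f k) \<le> n"
  by (induction A rule: infinite_finite_induct)
     (simp_all add: total_degree_add_le, simp_all add: total_degree_def)

text \<open>A nonzero coefficient of the product forces a nonzero term in the double convolution,
  and the exponents of its two factors add up to \<open>i\<close> and \<open>j\<close>.\<close>

lemma total_degree_mult_le:
  assumes "total_degree f \<le> m" "total_degree g \<le> n"
  shows "total_degree (f * g) \<le> m + n"
  unfolding total_degree_le_iff
proof (intro allI impI)
  fix i j assume "coeff (coeff (f * g) j) i \<noteq> 0"
  then have "(\<Sum>k\<le>j. \<Sum>l\<le>i. coeff (coeff f k) l * coeff (coeff g (j - k)) (i - l)) \<noteq> 0"
    by (simp add: coeff_mult coeff_sum)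
  then obtain k where k: "k \<le> j"
      "(\<Sum>l\<le>i. coeff (coeff f k) l * coeff (coeff g (j - k)) (i - l)) \<noteq> 0"
    by (meson atMost_iff sum.not_neutral_contains_not_neutral)
  then obtain l where l: "l \<le> i" "coeff (coeff f k) l * coeff (coeff g (j - k)) (i - l) \<noteq> 0"
    by (meson atMost_iff sum.not_neutral_contains_not_neutral)
  then have "l + k \<le> m" "(i - l) + (j - k) \<le> n"
    using assms unfolding total_degree_le_iff by (metis mult_zero_left mult_zero_right)+
  with k l show "i + j \<le> m + n"
    by linarith
qed

lemma total_degree_scalar: "total_degree (scalar c) = 0"
proof -
  have "total_degree (scalar c) \<le> 0"
    unfolding total_degree_le_iff by (auto simp: scalar_def coeff_pCons split: nat.splits)
  then show ?thesis
    by simp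
qed

lemma total_degree_power_le: "total_degree f \<le> m \<Longrightarrow> total_degree (f ^ n) \<le> n * m"
proof (induction n)
  case 0
  show ?case
    using total_degree_scalar[of 1] by (simp add: scalar_def pCons_one)
next
  case (Suc n)
  then show ?case
    using total_degree_mult_le[of f m "f ^ n" "n * m"] by simp
qed

lemma total_degree_const: "total_degree [:p:] \<le> degree p"
  unfolding total_degree_le_iff by (auto simp: coeff_pCons le_degree split: nat.splits)

lemma total_degree_linear: "total_degree [:p, [:c:]:] \<le> max 1 (degree p)"
  unfolding total_degree_le_iff
  by (auto simp: coeff_pCons le_degree le_max_iff_disj split: nat.splits)

lemma var_x_power: "var_x ^ i = [:monom 1 i:]"
  by (induction i) (simp_all add: var_x_def monom_Suc pCons_one)

lemma var_y_power: "var_y ^ j = monom 1 j"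
  by (induction j) (simp_all add: var_y_def monom_Suc pCons_one)

lemma scalar_mult_monomial: "scalar c * var_x ^ i * var_y ^ j = monom (monom c i) j"
  by (simp add: scalar_def var_x_power var_y_power smult_monom)

text \<open>Summing over the square of exponents up to \<open>d\<close> instead of the triangle
  gives a plain double sum; the extra coefficients vanish. Any bound \<open>d\<close> is allowed, so
  one index range serves all polynomials of degree at most \<open>d\<close>.\<close>

lemma monomial_expansion:
  assumes "total_degree f \<le> d"
  shows "f = (\<Sum>j\<le>d. \<Sum>i\<le>d. scalar (coeff (coeff f j) i) * var_x ^ i * var_y ^ j)"
proof (intro poly_eqI)
  fix l k
  have zero: "coeff (coeff f l) k = 0" if "d < l \<or> d < k"
    using assms that unfolding total_degree_le_iff by fastforce
  have "(\<Sum>i\<le>d. coeff (coeff (monom (monom (coeff (coeff f j) i) i) j) l) k) =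
      (if j = l then coeff (coeff f j) k else 0)" if "j \<le> d" for j
    using zero by (cases "k \<le> d") auto
  then show "coeff (coeff f l) k = coeff (coeff
      (\<Sum>j\<le>d. \<Sum>i\<le>d. scalar (coeff (coeff f j) i) * var_x ^ i * var_y ^ j) l) k"
    unfolding scalar_mult_monomial
    using zero by (cases "l \<le> d") (simp_all add: coeff_sum del: coeff_monom)
qed


section \<open>Automorphisms and derivations\<close>

lemma automorphismsD:
  assumes "\<rho> \<in> automorphisms"
  shows "bij \<rho>" "\<rho> (f + g) = \<rho> f + \<rho> g" "\<rho> (f * g) = \<rho> f * \<rho> g" "\<rho> (scalar c) = scalar c"
  using assms by (auto simp: automorphisms_def)

lemma
  assumes "\<rho> \<in> automorphisms"
  shows automorphism_0: "\<rho> 0 = 0"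
    and automorphism_1: "\<rho> 1 = 1"
    and automorphism_power: "\<rho> (f ^ n) = \<rho> f ^ n"
    and automorphism_sum: "\<rho> (\<Sum>k\<in>A. h k) = (\<Sum>k\<in>A. \<rho> (h k))"
proof -
  show 0: "\<rho> 0 = 0"
    using automorphismsD(4)[OF assms, of 0] by (simp add: scalar_def)
  show 1: "\<rho> 1 = 1"
    using automorphismsD(4)[OF assms, of 1] by (simp add: scalar_def pCons_one)
  show "\<rho> (f ^ n) = \<rho> f ^ n"
    by (induction n) (simp_all add: 1 automorphismsD(3)[OF assms])
  show "\<rho> (\<Sum>k\<in>A. h k) = (\<Sum>k\<in>A. \<rho> (h k))"
    by (induction A rule: infinite_finite_induct) (simp_all add: 0 automorphismsD(2)[OF assms])
qed

lemma automorphism_const: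
  assumes "\<rho> \<in> automorphisms" "\<rho> var_x = [:r:]"
  shows "\<rho> [:p:] = [:pcompose p r:]"
proof (induction p)
  case 0
  then show ?case
    using automorphism_0[OF assms(1)] by simp
next
  case (pCons a p)
  have "[:pCons a p:] = scalar a + var_x * [:p:]"
    by (simp add: scalar_def var_x_def)
  then have "\<rho> [:pCons a p:] = scalar a + [:r:] * [:pcompose p r:]"
    by (simp only: assms(2) pCons(2) automorphismsD[OF assms(1)])
  then show ?case
    by (simp add: scalar_def pcompose_pCons)
qed

lemma total_degree_automorphism_le:
  assumes "\<rho> \<in> automorphisms"
  shows "total_degree (\<rho> f) \<le> total_degree f * aut_degree \<rho>"
proof -
  define d where "d = total_degree f"
  have "\<rho> f = (\<Sum>j\<le>d. \<Sum>i\<le>d. scalar (coeff (coeff f j) i) * \<rho> var_x ^ i * \<rho> var_y ^ j)"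
    by (subst monomial_expansion[of f d])
       (simp_all add: d_def automorphism_sum[OF assms] automorphism_power[OF assms]
          automorphismsD[OF assms])
  also have "total_degree \<dots> \<le> d * aut_degree \<rho>"
  proof (intro total_degree_sum_le)
    fix i j
    show "total_degree (scalar (coeff (coeff f j) i) * \<rho> var_x ^ i * \<rho> var_y ^ j)
        \<le> d * aut_degree \<rho>"
    \<comment> \<open>In the part of the square with \<open>i + j > d\<close> the degree estimate
      fails, but there the coefficient is zero.\<close>
    proof (cases "coeff (coeff f j) i = 0")
      case True
      then show ?thesis
        by (simp add: scalar_def total_degree_def)
    next
      case False
      then have "i + j \<le> d"
        using d_def total_degree_le_iff by blast
      have "total_degree (scalar (coeff (coeff f j) i) * \<rho> var_x ^ i * \<rho> var_y ^ j)
          \<le> 0 + i * aut_degree \<rho> + j * aut_degree \<rho>"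
        by (intro total_degree_mult_le total_degree_power_le)
           (simp_all add: total_degree_scalar aut_degree_def)
      also have "\<dots> \<le> d * aut_degree \<rho>"
        using \<open>i + j \<le> d\<close> by (simp flip: add_mult_distrib)
      finally show ?thesis .
    qed
  qed
  finally show ?thesis
    by (simp add: d_def)
qed

lemma aut_degree_comp_le:
  assumes "\<rho> \<in> automorphisms"
  shows "aut_degree (\<rho> \<circ> \<sigma>) \<le> aut_degree \<sigma> * aut_degree \<rho>"
proof -
  have "total_degree (\<rho> (\<sigma> f)) \<le> aut_degree \<sigma> * aut_degree \<rho>"
    if "total_degree (\<sigma> f) \<le> aut_degree \<sigma>" for f
    using total_degree_automorphism_le[OF assms] mult_le_mono1[OF that] order_trans by blast
  then show ?thesis
    by (simp add: aut_degree_def[of "\<rho> \<circ> \<sigma>"]) (simp add: aut_degree_def[of \<sigma>])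
qed

section \<open>Conjugation and isotropy groups\<close>

lemma automorphisms_comp: "\<rho> \<in> automorphisms \<Longrightarrow> \<sigma> \<in> automorphisms \<Longrightarrow> \<rho> \<circ> \<sigma> \<in> automorphisms"
  by (auto simp: automorphisms_def bij_comp)

lemma automorphism_inverse:
  assumes "\<rho> \<in> automorphisms"
  obtains \<sigma> where "\<sigma> \<in> automorphisms" "\<rho> \<circ> \<sigma> = id" "\<sigma> \<circ> \<rho> = id" "inv_into UNIV \<rho> = \<sigma>"
proof -
  obtain \<sigma> where \<sigma>: "\<sigma> \<in> automorphisms" "\<sigma> \<circ> \<rho> = id"
    using group.l_inv_ex[OF group_automorphism_group, of \<rho>] assms
    by (auto simp: automorphism_group_def)
  moreover have "\<rho> \<circ> \<sigma> = id"
    using \<sigma>(2) automorphismsD(1)[OF assms]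
    by (metis bij_is_surj fun.map_id0 id_apply inv_o_cancel o_assoc surj_iff bij_is_inj inj_iff
        comp_id id_comp)
  ultimately show ?thesis
    using that inv_unique_comp by blast
qed

text \<open>Expressing each derivation through the other lets properties be transported in both
  directions.\<close>

lemma conjugateE:
  assumes "conjugate D D'"
  obtains \<phi> \<psi> where "\<phi> \<in> automorphisms" "\<psi> \<in> automorphisms" "\<And>f. \<phi> (\<psi> f) = f"
    "\<And>f. \<psi> (\<phi> f) = f" "D' = \<phi> \<circ> D \<circ> \<psi>" "D = \<psi> \<circ> D' \<circ> \<phi>"
proof -
  obtain \<phi> where \<phi>: "\<phi> \<in> automorphisms" "D' = \<phi> \<circ> D \<circ> inv_into UNIV \<phi>"
    using assms by (auto simp: conjugate_def)
  obtain \<psi> where \<psi>: "\<psi> \<in> automorphisms" "\<phi> \<circ> \<psi> = id" "\<psi> \<circ> \<phi> = id" "inv_into UNIV \<phi> = \<psi>"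
    using automorphism_inverse[OF \<phi>(1)] by blast
  show ?thesis
    by (rule that[OF \<phi>(1) \<psi>(1)])
       (use \<phi>(2) \<psi>(2-4) in \<open>auto simp: fun_eq_iff\<close>)
qed

lemma isotropy_comp_conj:
  assumes "\<phi> \<in> automorphisms" "\<psi> \<in> automorphisms" "\<And>f. \<phi> (\<psi> f) = f" "\<And>f. \<psi> (\<phi> f) = f"
    "\<rho> \<in> isotropy D"
  shows "\<phi> \<circ> \<rho> \<circ> \<psi> \<in> isotropy (\<phi> \<circ> D \<circ> \<psi>)"
proof -
  have "\<rho> \<in> automorphisms" "\<And>f. \<rho> (D f) = D (\<rho> f)"
    using assms(5) by (simp_all add: isotropy_def fun_eq_iff)
  then show ?thesis
    using assms(1-4) by (simp add: isotropy_def fun_eq_iff automorphisms_comp)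
qed

text \<open>An element \<rho> of the isotropy group is recovered from its conjugate by composing
  with the fixed maps \<psi> and \<phi>, and degrees at most multiply under composition.\<close>

lemma isotropy_conj_bounded:
  assumes "\<phi> \<in> automorphisms" "\<psi> \<in> automorphisms" "\<And>f. \<phi> (\<psi> f) = f" "\<And>f. \<psi> (\<phi> f) = f"
    "isotropy (\<phi> \<circ> D \<circ> \<psi>) \<subseteq> automorphisms_upto d"
  shows "isotropy D \<subseteq> automorphisms_upto (aut_degree \<phi> * (d * aut_degree \<psi>))"
proof
  fix \<rho> assume \<rho>: "\<rho> \<in> isotropy D"
  let ?\<sigma> = "\<phi> \<circ> \<rho> \<circ> \<psi>"
  have "\<rho> = \<psi> \<circ> ?\<sigma> \<circ> \<phi>"
    using assms(4) by (simp add: fun_eq_iff)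
  have \<sigma>: "?\<sigma> \<in> automorphisms" "aut_degree ?\<sigma> \<le> d"
    using isotropy_comp_conj[OF assms(1-4) \<rho>] assms(5) by (auto simp: automorphisms_upto_def)
  have "aut_degree (\<psi> \<circ> ?\<sigma>) \<le> d * aut_degree \<psi>"
    using aut_degree_comp_le[OF assms(2)] mult_le_mono1[OF \<sigma>(2)] order_trans by blast
  then have "aut_degree (\<psi> \<circ> ?\<sigma> \<circ> \<phi>) \<le> aut_degree \<phi> * (d * aut_degree \<psi>)"
    using aut_degree_comp_le[OF automorphisms_comp[OF assms(2) \<sigma>(1)], of \<phi>] mult_le_mono2
      order_trans by blast
  then show "\<rho> \<in> automorphisms_upto (aut_degree \<phi> * (d * aut_degree \<psi>))"
    using \<open>\<rho> = _\<close> \<rho> by (simp add: automorphisms_upto_def isotropy_def)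
qed

section \<open>Derivations and their values on the variables\<close>

lemma derivationD:
  assumes "derivation D"
  shows "D (f + g) = D f + D g" "D (scalar c * f) = scalar c * D f" "D (f * g) = D f * g + f * D g"
  using assms by (auto simp: derivation_def)

lemma
  assumes "derivation D"
  shows derivation_0: "D 0 = 0"
    and derivation_scalar: "D (scalar c) = 0"
    and derivation_sum: "D (\<Sum>k\<in>A. h k) = (\<Sum>k\<in>A. D (h k))"
proof -
  show 0: "D 0 = 0"
    by (metis add_0 add_cancel_right_right derivationD(1)[OF assms])
  show "D (\<Sum>k\<in>A. h k) = (\<Sum>k\<in>A. D (h k))"
    by (induction A rule: infinite_finite_induct) (simp_all add: 0 derivationD(1)[OF assms])
  have "D 1 = D 1 + D 1"
    using derivationD(3)[OF assms, of 1 1] by (simp only: mult_1_left mult_1_right)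
  then have "D 1 = 0"
    by (simp only: add_cancel_right_right)
  then show "D (scalar c) = 0"
    using derivationD(2)[OF assms, of c 1] by simp
qed

lemma derivation_conj:
  assumes "\<phi> \<in> automorphisms" "\<psi> \<in> automorphisms" "\<And>f. \<phi> (\<psi> f) = f" "derivation D"
  shows "derivation (\<phi> \<circ> D \<circ> \<psi>)"
  unfolding derivation_def
  by (simp add: automorphismsD[OF assms(1)] automorphismsD[OF assms(2)] derivationD[OF assms(4)]
      assms(3) derivation_scalar[OF assms(4)] automorphism_0[OF assms(1)])

text \<open>The chain rule for polynomials in x, by Leibniz along p = a + x q. It later turns the
  vanishing of a derivation on a nonconstant polynomial in x into its vanishing on x.\<close>

lemma derivation_const:
  assumes "derivation D"
  shows "D [:p:] = [:pderiv p:] * D var_x"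
proof (induction p)
  case 0
  then show ?case
    by (simp add: derivation_0[OF assms])
next
  case (pCons a p)
  have "[:pCons a p:] = scalar a + var_x * [:p:]"
    by (simp add: scalar_def var_x_def)
  then have "D [:pCons a p:] = D var_x * [:p:] + var_x * ([:pderiv p:] * D var_x)"
    by (simp only: pCons(2) derivationD[OF assms] derivation_scalar[OF assms] add_0)
  also have "\<dots> = ([:p:] + var_x * [:pderiv p:]) * D var_x"
    by (simp only: algebra_simps)
  finally show ?case
    by (simp add: pderiv_pCons var_x_def)
qed

lemma derivation_eq_mult_pderiv:
  assumes "derivation D" "D var_x = 0"
  shows "D f = D var_y * pderiv f"
proof (induction f)
  case 0
  then show ?case
    by (simp add: derivation_0[OF assms(1)])
next
  case (pCons p f)
  have "pCons p f = [:p:] + var_y * f"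
    by (simp add: var_y_def)
  then have "D (pCons p f) = D var_y * f + var_y * (D var_y * pderiv f)"
    by (simp only: derivation_const[OF assms(1)] pCons(2) assms(2) derivationD[OF assms(1)]
        mult_zero_right add_0)
  also have "\<dots> = D var_y * (f + var_y * pderiv f)"
    by (simp only: algebra_simps)
  finally show ?case
    by (simp add: pderiv_pCons var_y_def)
qed


section \<open>The isotropy group is closed\<close>

text \<open>Members of \<open>coeff_functions d\<close> are functions on all maps, whereas the
  useful identities (expansion in monomials, vanishing of high coefficients) hold only for
  automorphisms of degree at most \<open>d\<close>. Hence agreement is required only there.\<close>

definition regular_upto :: "nat \<Rightarrow> (('a::field poly poly \<Rightarrow> 'a poly poly) \<Rightarrow> 'a) \<Rightarrow> bool" where
  "regular_upto d F \<longleftrightarrow> (\<exists>p\<in>coeff_functions d. \<forall>\<rho>\<in>automorphisms_upto d. F \<rho> = p \<rho>)"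

lemma coeff_function_regular: "p \<in> coeff_functions d \<Longrightarrow> regular_upto d p"
  unfolding regular_upto_def by blast

lemma regular_upto_const: "regular_upto d (\<lambda>_. c)"
  by (intro coeff_function_regular coeff_functions.const)

lemma regular_upto_add:
  assumes "regular_upto d F" "regular_upto d G"
  shows "regular_upto d (\<lambda>\<rho>. F \<rho> + G \<rho>)"
proof -
  obtain p q where "p \<in> coeff_functions d" "q \<in> coeff_functions d"
    "\<forall>\<rho>\<in>automorphisms_upto d. F \<rho> = p \<rho>" "\<forall>\<rho>\<in>automorphisms_upto d. G \<rho> = q \<rho>"
    using assms unfolding regular_upto_def by blast
  then show ?thesis
    unfolding regular_upto_def by (intro bexI[OF _ coeff_functions.add[of p d q]]) auto
qed

lemma regular_upto_mult:
  assumes "regular_upto d F" "regular_upto d G"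
  shows "regular_upto d (\<lambda>\<rho>. F \<rho> * G \<rho>)"
proof -
  obtain p q where "p \<in> coeff_functions d" "q \<in> coeff_functions d"
    "\<forall>\<rho>\<in>automorphisms_upto d. F \<rho> = p \<rho>" "\<forall>\<rho>\<in>automorphisms_upto d. G \<rho> = q \<rho>"
    using assms unfolding regular_upto_def by blast
  then show ?thesis
    unfolding regular_upto_def by (intro bexI[OF _ coeff_functions.mult[of p d q]]) auto
qed

lemma regular_upto_sum:
  "(\<And>k. k \<in> A \<Longrightarrow> regular_upto d (F k)) \<Longrightarrow> regular_upto d (\<lambda>\<rho>. \<Sum>k\<in>A. F k \<rho>)"
  by (induction A rule: infinite_finite_induct)
     (auto simp: regular_upto_const regular_upto_add)

text \<open>For \<open>i + j > d\<close> this coefficient is not among the generators of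
  \<open>coeff_functions d\<close>, but it vanishes on automorphisms of degree at most
  \<open>d\<close>, so the constant 0 represents it.\<close>

lemma regular_upto_coeff_var:
  assumes "v = var_x \<or> v = var_y"
  shows "regular_upto d (\<lambda>\<rho>. coeff (coeff (\<rho> v) j) i)"
proof (cases "i + j \<le> d")
  case True
  then show ?thesis
    using assms coeff_functions.coeff_x[of i j d] coeff_functions.coeff_y[of i j d]
    by (auto intro: coeff_function_regular)
next
  case False
  have "coeff (coeff (\<rho> v) j) i = 0" if "\<rho> \<in> automorphisms_upto d" for \<rho>
  proof -
    from that assms have "total_degree (\<rho> v) \<le> d"
      by (auto simp: automorphisms_upto_def aut_degree_def)
    with False show ?thesis
      unfolding total_degree_le_iff by blast
  qed
  then show ?thesis
    unfolding regular_upto_def by (intro bexI[OF _ coeff_functions.const[of 0 d]]) simp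
qed

definition poly_regular ::
    "nat \<Rightarrow> (('a::field poly poly \<Rightarrow> 'a poly poly) \<Rightarrow> 'a poly poly) \<Rightarrow> bool" where
  "poly_regular d F \<longleftrightarrow> (\<forall>i j. regular_upto d (\<lambda>\<rho>. coeff (coeff (F \<rho>) j) i))"

lemma poly_regular_const: "poly_regular d (\<lambda>_. f)"
  by (simp add: poly_regular_def regular_upto_const)

lemma poly_regular_add: "poly_regular d F \<Longrightarrow> poly_regular d G \<Longrightarrow> poly_regular d (\<lambda>\<rho>. F \<rho> + G \<rho>)"
  by (simp add: poly_regular_def regular_upto_add)

lemma poly_regular_mult: "poly_regular d F \<Longrightarrow> poly_regular d G \<Longrightarrow> poly_regular d (\<lambda>\<rho>. F \<rho> * G \<rho>)"
  by (simp add: poly_regular_def coeff_mult coeff_sum regular_upto_sum regular_upto_mult)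

lemma poly_regular_power: "poly_regular d F \<Longrightarrow> poly_regular d (\<lambda>\<rho>. F \<rho> ^ n)"
  by (induction n) (simp_all add: poly_regular_const poly_regular_mult)

lemma poly_regular_sum:
  "(\<And>k. k \<in> A \<Longrightarrow> poly_regular d (F k)) \<Longrightarrow> poly_regular d (\<lambda>\<rho>. \<Sum>k\<in>A. F k \<rho>)"
  by (simp add: poly_regular_def coeff_sum regular_upto_sum)

lemma poly_regular_scalar:
  fixes F :: "('a::field poly poly \<Rightarrow> 'a poly poly) \<Rightarrow> 'a"
  shows "regular_upto d F \<Longrightarrow> poly_regular d (\<lambda>\<rho>. scalar (F \<rho>))"
proof -
  have coeff_scalar: "coeff (coeff (scalar c) j) i = (if i = 0 \<and> j = 0 then c else 0)"
    for c :: 'a and i j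
    by (simp add: scalar_def coeff_pCons split: nat.splits)
  then show "poly_regular d (\<lambda>\<rho>. scalar (F \<rho>))" if "regular_upto d F"
    unfolding poly_regular_def
  proof (intro allI)
    fix i j
    show "regular_upto d (\<lambda>\<rho>. coeff (coeff (scalar (F \<rho>)) j) i)"
      using that by (cases i; cases j) (simp_all add: coeff_scalar regular_upto_const)
  qed
qed

lemma poly_regular_var: "v = var_x \<or> v = var_y \<Longrightarrow> poly_regular d (\<lambda>\<rho>. \<rho> v)"
  by (simp add: poly_regular_def regular_upto_coeff_var)

lemma poly_regular_cong:
  "poly_regular d G \<Longrightarrow> (\<And>\<rho>. \<rho> \<in> automorphisms_upto d \<Longrightarrow> F \<rho> = G \<rho>) \<Longrightarrow> poly_regular d F"
  by (simp add: poly_regular_def regular_upto_def)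

text \<open>For fixed \<open>f\<close>, \<rho>(f) is a polynomial expression in \<rho>(x) and
  \<rho>(y) with constant coefficients. Its size is governed by the degree of \<open>f\<close>,
  independently of \<open>d\<close>.\<close>

lemma poly_regular_apply: "poly_regular d (\<lambda>\<rho>. \<rho> f)"
proof -
  define e where "e = total_degree f"
  have expansion: "\<rho> f = (\<Sum>j\<le>e. \<Sum>i\<le>e. scalar (coeff (coeff f j) i) * \<rho> var_x ^ i * \<rho> var_y ^ j)"
    if "\<rho> \<in> automorphisms_upto d" for \<rho>
  proof -
    from that have "\<rho> \<in> automorphisms"
      by (simp add: automorphisms_upto_def)
    then show ?thesis
      by (subst monomial_expansion[of f e])
         (simp_all add: e_def automorphism_sum automorphism_power automorphismsD)
  qed
  show ?thesis
    by (rule poly_regular_cong[rotated], erule expansion)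
       (intro poly_regular_sum poly_regular_mult poly_regular_power poly_regular_const
          poly_regular_var[OF disjI1[OF refl]] poly_regular_var[OF disjI2[OF refl]])
qed

text \<open>Here the argument \<rho>(v) varies, so it is expanded up to the uniform bound
  \<open>d\<close>. By linearity \<open>D\<close> meets only fixed monomials, and the coefficients
  of \<rho>(v) are regular.\<close>

lemma poly_regular_derivation:
  assumes "derivation D" "v = var_x \<or> v = var_y"
  shows "poly_regular d (\<lambda>\<rho>. D (\<rho> v))"
proof -
  have expansion: "D (\<rho> v) = (\<Sum>j\<le>d. \<Sum>i\<le>d. scalar (coeff (coeff (\<rho> v) j) i) * D (var_x ^ i * var_y ^ j))"
    if "\<rho> \<in> automorphisms_upto d" for \<rho>
  proof -
    from that assms(2) have "total_degree (\<rho> v) \<le> d"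
      by (auto simp: automorphisms_upto_def aut_degree_def)
    then show ?thesis
      by (subst monomial_expansion[of "\<rho> v" d])
         (simp_all add: derivation_sum[OF assms(1)] derivationD(2)[OF assms(1)] mult.assoc)
  qed
  show ?thesis
    by (rule poly_regular_cong[rotated], erule expansion)
       (intro poly_regular_sum poly_regular_mult poly_regular_scalar poly_regular_const
          regular_upto_coeff_var[OF assms(2)])
qed

lemma closedin_poly_regular:
  assumes "\<And>F. F \<in> \<F> \<Longrightarrow> poly_regular d F"
  shows "closedin (zariski_topology d) {\<rho>\<in>automorphisms_upto d. \<forall>F\<in>\<F>. F \<rho> = 0}"
proof -
  \<comment> \<open>All coefficient functions that represent some coefficient of some member of
    \<F>; their common zeros are those of \<F>.\<close>
  define S where "S = {p\<in>coeff_functions d. \<exists>F\<in>\<F>. \<exists>i j.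
    \<forall>\<rho>\<in>automorphisms_upto d. coeff (coeff (F \<rho>) j) i = p \<rho>}"
  have "(\<forall>F\<in>\<F>. F \<rho> = 0) \<longleftrightarrow> (\<forall>p\<in>S. p \<rho> = 0)" if \<rho>: "\<rho> \<in> automorphisms_upto d" for \<rho>
  proof safe
    fix p assume "\<forall>F\<in>\<F>. F \<rho> = 0" "p \<in> S"
    with \<rho> show "p \<rho> = 0"
      unfolding S_def by (smt (verit) coeff_0 mem_Collect_eq)
  next
    fix F assume S: "\<forall>p\<in>S. p \<rho> = 0" and F: "F \<in> \<F>"
    show "F \<rho> = 0"
    proof (intro poly_eqI)
      fix j i
      obtain p where p: "p \<in> coeff_functions d"
          "\<forall>\<rho>\<in>automorphisms_upto d. coeff (coeff (F \<rho>) j) i = p \<rho>"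
        using assms[OF F] unfolding poly_regular_def regular_upto_def by blast
      then have "p \<in> S"
        unfolding S_def using F by blast
      with S p \<rho> show "coeff (coeff (F \<rho>) j) i = coeff (coeff 0 j) i"
        by simp
    qed
  qed
  then have "{\<rho>\<in>automorphisms_upto d. \<forall>F\<in>\<F>. F \<rho> = 0} =
      {\<rho>\<in>automorphisms_upto d. \<forall>p\<in>S. p \<rho> = 0}"
    by blast
  moreover have "S \<subseteq> coeff_functions d"
    by (auto simp: S_def)
  ultimately show ?thesis
    unfolding closedin_zariski_topology by blast
qed

text \<open>Both sides are derivations along \<open>\<rho>\<close>, so it suffices to compare them on x and y.\<close>

lemma isotropy_iff:
  assumes "derivation D" "\<rho> \<in> automorphisms"
  shows "\<rho> \<in> isotropy D \<longleftrightarrow> \<rho> (D var_x) = D (\<rho> var_x) \<and> \<rho> (D var_y) = D (\<rho> var_y)"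
proof
  assume eq: "\<rho> (D var_x) = D (\<rho> var_x) \<and> \<rho> (D var_y) = D (\<rho> var_y)"
  note simps = automorphismsD(2-4)[OF assms(2)] automorphism_0[OF assms(2)]
    derivationD[OF assms(1)] derivation_0[OF assms(1)] derivation_scalar[OF assms(1)]
  have const: "\<rho> (D [:p:]) = D (\<rho> [:p:])" for p
  proof (induction p)
    case (pCons a p)
    have "[:pCons a p:] = scalar a + var_x * [:p:]"
      by (simp add: scalar_def var_x_def)
    with pCons(2) eq show ?case
      by (simp only: simps add_0)
  qed (simp add: simps)
  have "\<rho> (D f) = D (\<rho> f)" for f
  proof (induction f)
    case (pCons p f)
    have "pCons p f = [:p:] + var_y * f"
      by (simp add: var_y_def)
    with pCons(2) eq const show ?case
      by (simp only: simps)
  qed (simp add: simps)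
  with assms(2) show "\<rho> \<in> isotropy D"
    by (auto simp: isotropy_def)
qed (simp add: isotropy_def fun_eq_iff)

lemma closedin_isotropy:
  assumes "derivation D"
  shows "closedin ind_topology (isotropy (D :: 'a::field poly poly \<Rightarrow> _))"
  unfolding closedin_ind_topology
proof (intro conjI allI)
  show "isotropy D \<subseteq> automorphisms"
    by (auto simp: isotropy_def)
  fix d
  \<comment> \<open>The difference is written with the factor -1 so that the closure of regular maps
    under sums and products applies directly.\<close>
  define F where "F v = (\<lambda>\<rho>. \<rho> (D v) + scalar (- 1) * D (\<rho> v))" for v
  have "scalar (- 1) = (- 1 :: 'a poly poly)"
    by (simp add: scalar_def one_pCons)
  then have F_eq_0: "F v \<rho> = 0 \<longleftrightarrow> \<rho> (D v) = D (\<rho> v)" for v \<rho>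
    by (simp add: F_def)
  have "poly_regular d (F v)" if "v \<in> {var_x, var_y}" for v
    unfolding F_def using that assms
    by (intro poly_regular_add poly_regular_mult poly_regular_apply poly_regular_const
        poly_regular_derivation) auto
  then have "closedin (zariski_topology d)
      {\<rho>\<in>automorphisms_upto d. \<forall>G\<in>F ` {var_x, var_y}. G \<rho> = 0}"
    by (intro closedin_poly_regular) blast
  also have "{\<rho>\<in>automorphisms_upto d. \<forall>G\<in>F ` {var_x, var_y}. G \<rho> = 0} =
      isotropy D \<inter> automorphisms_upto d"
    using isotropy_iff[OF assms] by (auto simp: F_eq_0 automorphisms_upto_def)
  finally show "closedin (zariski_topology d) (isotropy D \<inter> automorphisms_upto d)" .
qed

lemma isotropy_inverse:
  assumes "\<rho> \<in> isotropy D" "\<rho> \<circ> \<sigma> = id" "\<sigma> \<circ> \<rho> = id" "\<sigma> \<in> automorphisms"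
  shows "\<sigma> \<in> isotropy D"
  using assms unfolding isotropy_def mem_Collect_eq fun_eq_iff comp_apply id_apply by metis

lemma subgroup_isotropy: "subgroup (isotropy D) automorphism_group"
proof (rule group.subgroupI[OF group_automorphism_group])
  have "id \<in> automorphisms"
    using group.is_monoid[OF group_automorphism_group, THEN monoid.one_closed]
    by (simp add: automorphism_group_def)
  then show "isotropy D \<noteq> {}"
    by (auto simp: isotropy_def)
  fix \<rho> assume \<rho>: "\<rho> \<in> isotropy D"
  then have carrier: "\<rho> \<in> carrier automorphism_group"
    by (simp add: isotropy_def automorphism_group_def)
  let ?\<sigma> = "inv\<^bsub>automorphism_group\<^esub> \<rho>"
  show "?\<sigma> \<in> isotropy D"
    using group.inv_closed[OF group_automorphism_group carrier]
      group.r_inv[OF group_automorphism_group carrier]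
      group.l_inv[OF group_automorphism_group carrier]
    by (intro isotropy_inverse[OF \<rho>]) (simp_all add: automorphism_group_def)
next
  fix \<rho> \<sigma> assume "\<rho> \<in> isotropy D" "\<sigma> \<in> isotropy D"
  then show "\<rho> \<otimes>\<^bsub>automorphism_group\<^esub> \<sigma> \<in> isotropy D"
    by (auto simp: isotropy_def automorphism_group_def automorphisms_comp fun_eq_iff)
qed (auto simp: isotropy_def automorphism_group_def)


section \<open>Multiples of the y-derivative\<close>

lemma locally_nilpotent_conj:
  assumes "\<phi> \<in> automorphisms" "\<psi> \<in> automorphisms" "\<And>f. \<phi> (\<psi> f) = f" "locally_nilpotent D"
  shows "locally_nilpotent (\<psi> \<circ> D \<circ> \<phi>)"
proof -
  \<comment> \<open>Inner factors cancel by \<phi>(\<psi> f) = f. Starting at n = 1 avoids the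
    opposite identity \<psi>(\<phi> f) = f, and local nilpotency supplies a positive exponent
    anyway.\<close>
  have "((\<psi> \<circ> D \<circ> \<phi>) ^^ n) f = \<psi> ((D ^^ n) (\<phi> f))" if "n > 0" for n f
    using that by (induction n rule: nat_induct_non_zero) (simp_all add: assms(3))
  then show ?thesis
    using assms(4) automorphism_0[OF assms(2)] unfolding locally_nilpotent_def by metis
qed

lemma locally_nilpotent_mult_pderiv:
  fixes b :: "'a::field_char_0 poly poly"
  assumes "b \<in> polys_in_x"
  shows "locally_nilpotent (\<lambda>f. b * pderiv f)"
proof -
  let ?D = "\<lambda>f. b * pderiv f"
  obtain p where b: "b = [:p:]"
    using assms by (auto simp: polys_in_x_def)
  have zero: "(?D ^^ n) 0 = 0" for n
    by (induction n) simp_all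
  \<comment> \<open>As \<open>b\<close> is constant in y, each application lowers the y-degree.
    Degree 0 is treated separately: there f is killed at once, but truncated subtraction shows no
    drop.\<close>
  have "(?D ^^ n) f = 0" if "degree f < n" for n f
    using that
  proof (induction n arbitrary: f)
    case (Suc n)
    show ?case
    proof (cases "degree f = 0")
      case True
      then have "?D f = 0"
        by (simp add: pderiv_eq_0_iff)
      then show ?thesis
        using zero[of n] by (simp only: funpow_Suc_right comp_apply)
    next
      case False
      then have "degree (?D f) < n"
        using Suc.prems degree_smult_le[of p "pderiv f"] by (simp add: b degree_pderiv)
      then show ?thesis
        using Suc.IH[of "?D f"] by (simp only: funpow_Suc_right comp_apply)
    qed
  qed simp
  then show ?thesis
    unfolding locally_nilpotent_def by (metis lessI zero_less_Suc)
qed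

lemma isotropy_mult_pderiv_unbounded:
  fixes b :: "'a::field poly poly"
  assumes "b \<in> polys_in_x"
  shows "\<not> isotropy (\<lambda>f. b * pderiv f) \<subseteq> automorphisms_upto d"
proof -
  obtain p where b: "b = [:p:]"
    using assms by (auto simp: polys_in_x_def)
  define n where "n = Suc d"
  define q where "q = (monom 1 n :: 'a poly)"
  \<comment> \<open>Composition in the outer variable sends y to y + x^n and fixes every polynomial
    in x, in particular \<open>b\<close>. The inverse uses \<open>- q\<close>, and n = d + 1 exceeds
    the given bound.\<close>
  define \<rho> where "\<rho> = (\<lambda>f. pcompose f [:q, 1:])"
  have "pcompose (pcompose f [:q, 1:]) [:- q, 1:] = f"
    "pcompose (pcompose f [:- q, 1:]) [:q, 1:] = f" for f
    by (simp_all add: pcompose_assoc pcompose_pCons flip: pcompose_assoc)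
  then have "bij \<rho>"
    unfolding \<rho>_def by (intro o_bij[of "\<lambda>f. pcompose f [:- q, 1:]"]) (auto simp: fun_eq_iff)
  then have "\<rho> \<in> automorphisms"
    by (simp add: automorphisms_def \<rho>_def pcompose_add pcompose_mult scalar_def)
  then have "\<rho> \<in> isotropy (\<lambda>f. b * pderiv f)"
    by (simp add: isotropy_def fun_eq_iff \<rho>_def b pcompose_smult pderiv_pcompose pderiv_pCons)
  moreover have "coeff (coeff (\<rho> var_y) 0) n \<noteq> 0"
    by (simp add: \<rho>_def var_y_def pcompose_pCons q_def)
  then have "\<not> total_degree (\<rho> var_y) \<le> d"
    unfolding total_degree_le_iff n_def by (metis add_0_right not_less_eq_eq order_refl)
  then have "\<rho> \<notin> automorphisms_upto d"
    by (simp add: automorphisms_upto_def aut_degree_def)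
  ultimately show ?thesis
    by blast
qed

section \<open>Bounded degree when \<open>b\<close> involves y\<close>

lemma degree_funpow_pderiv:
  fixes f :: "'a::{comm_semiring_1, semiring_no_zero_divisors, semiring_char_0} poly"
  shows "degree ((pderiv ^^ n) f) = degree f - n"
  by (induction n) (simp_all add: degree_pderiv)

lemma isotropy_mult_pderiv_form:
  fixes b :: "'a::field_char_0 poly poly"
  assumes "b \<noteq> 0" "\<rho> \<in> isotropy (\<lambda>f. b * pderiv f)"
  obtains r c p where "\<rho> var_x = [:r:]" "degree r = 1" "\<rho> var_y = [:p, [:c:]:]" "c \<noteq> 0"
    "\<rho> b = scalar c * b" "\<And>f. pderiv (\<rho> f) = scalar c * \<rho> (pderiv f)"
proof -
  have aut: "\<rho> \<in> automorphisms"
    using assms(2) by (simp add: isotropy_def)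
  have pderiv_var: "pderiv var_x = (0 :: 'a poly poly)" "pderiv var_y = (1 :: 'a poly poly)"
    by (simp_all add: var_x_def var_y_def pderiv_pCons)
  \<comment> \<open>The kernel of b d/dy consists of the polynomials in x. The claim is made for
    arbitrary \<tau> because it is applied to \<rho> and to its inverse.\<close>
  have preserves: "\<exists>r. \<tau> var_x = [:r:]" if "\<tau> \<in> isotropy (\<lambda>f. b * pderiv f)" for \<tau>
  proof -
    have aut: "\<tau> \<in> automorphisms" and "\<tau> (b * pderiv var_x) = b * pderiv (\<tau> var_x)"
      using that by (simp_all add: isotropy_def fun_eq_iff)
    then have "pderiv (\<tau> var_x) = 0"
      using assms(1) pderiv_var(1) automorphism_0[OF aut] by simp
    then show ?thesis
      by (meson degree_eq_zeroE pderiv_eq_0_iff)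
  qed
  obtain \<sigma> where \<sigma>: "\<sigma> \<in> automorphisms" "\<rho> \<circ> \<sigma> = id" "\<sigma> \<circ> \<rho> = id"
    using automorphism_inverse[OF aut] by metis
  have inv: "\<rho> (\<sigma> f) = f" for f
    using \<sigma>(2) by (simp add: fun_eq_iff)
  obtain r where r: "\<rho> var_x = [:r:]"
    using preserves assms(2) by blast
  obtain s where s: "\<sigma> var_x = [:s:]"
    using preserves isotropy_inverse[OF assms(2) \<sigma>(2,3,1)] by blast
  \<comment> \<open>On k[x] the two maps are substitutions inverse to each other, so the degrees of
    \<open>r\<close> and \<open>s\<close> multiply to 1.\<close>
  have "[:pcompose s r:] = var_x"
    using inv[of var_x] automorphism_const[OF aut r] s by simp
  then have "degree s * degree r = 1"
    by (metis degree_pcompose degree_pCons_eq_if one_neq_zero pCons_eq_0_iff pCons_eq_iff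
        var_x_def One_nat_def degree_0)
  then have "degree r = 1"
    by simp
  define P where "P = \<rho> var_y"
  have comm: "\<rho> b * \<rho> (pderiv f) = b * pderiv (\<rho> f)" for f
    using assms(2) automorphismsD(3)[OF aut] by (simp add: isotropy_def fun_eq_iff)
  have \<rho>b: "\<rho> b = b * pderiv P"
    using comm[of var_y] automorphism_1[OF aut] by (simp add: P_def pderiv_var)
  have chain: "pderiv (\<rho> f) = pderiv P * \<rho> (pderiv f)" for f
    using comm[of f] assms(1) by (simp add: \<rho>b mult.assoc)
  have "pderiv P * \<rho> (pderiv (\<sigma> var_y)) = 1"
    using chain[of "\<sigma> var_y"] by (simp add: inv pderiv_var)
  then have "pderiv P dvd 1"
    by (metis dvdI)
  then obtain e where e: "pderiv P = [:e:]" "e dvd 1"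
    by (auto simp: is_unit_poly_iff)
  then obtain c where "e = [:c:]" "c dvd 1"
    by (auto simp: is_unit_poly_iff)
  then have c: "e = [:c:]" "c \<noteq> 0"
    by auto
  \<comment> \<open>In characteristic zero a vanishing y-derivative leaves only a polynomial in
    x.\<close>
  have "pderiv (P - [:0, [:c:]:]) = 0"
    using e c by (simp add: pderiv_diff pderiv_pCons)
  then obtain p where "P - [:0, [:c:]:] = [:p:]"
    by (meson degree_eq_zeroE pderiv_eq_0_iff)
  then have "P = [:p, [:c:]:]"
    by (simp add: diff_eq_eq)
  then show ?thesis
    using that r \<open>degree r = 1\<close> c \<rho>b chain e by (simp add: P_def scalar_def)
qed

lemma isotropy_mult_pderiv_bounded:
  fixes b :: "'a::field_char_0 poly poly"
  assumes "degree b \<ge> 1"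
  shows "\<exists>d. isotropy (\<lambda>f. b * pderiv f) \<subseteq> automorphisms_upto d"
proof -
  define k where "k = degree b - 1"
  define g where "g = (pderiv ^^ k) b"
  define u v where "u = coeff g 1" and "v = coeff g 0"
  have "degree g = 1"
    using assms by (simp add: g_def k_def degree_funpow_pderiv)
  then have g: "g = [:v, u:]" "u \<noteq> 0"
    by (auto simp: u_def v_def poly_eq_iff coeff_pCons coeff_eq_0 split: nat.splits
        dest: leading_coeff_neq_0) (metis One_nat_def degree_0 leading_coeff_neq_0 zero_neq_one)
  have "b \<noteq> 0"
    using assms by auto
  have "aut_degree \<rho> \<le> max 1 (degree v)" if \<rho>: "\<rho> \<in> isotropy (\<lambda>f. b * pderiv f)" for \<rho>
  proof -
    have aut: "\<rho> \<in> automorphisms"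
      using \<rho> by (simp add: isotropy_def)
    obtain r c p where r: "\<rho> var_x = [:r:]" "degree r = 1" and P: "\<rho> var_y = [:p, [:c:]:]"
      and c: "c \<noteq> 0" "\<rho> b = scalar c * b"
      and chain: "\<And>f. pderiv (\<rho> f) = scalar c * \<rho> (pderiv f)"
      using isotropy_mult_pderiv_form[OF \<open>b \<noteq> 0\<close> \<rho>] by metis
    have pderiv_scalar: "pderiv (scalar e * f) = scalar e * pderiv f" for e :: 'a and f
      by (simp add: scalar_def pderiv_smult)
    \<comment> \<open>Differentiating \<rho>(b) = c b repeatedly: by the chain rule each derivative
      moved inside \<rho> contributes one more factor c.\<close>
    have "scalar (c ^ n) * \<rho> ((pderiv ^^ n) b) = scalar c * (pderiv ^^ n) b" for n
    proof (induction n)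
      case 0
      show ?case
        by (simp add: c(2) scalar_def)
    next
      case (Suc n)
      have "scalar (c ^ Suc n) * \<rho> ((pderiv ^^ Suc n) b) =
          pderiv (scalar (c ^ n) * \<rho> ((pderiv ^^ n) b))"
        by (simp only: pderiv_scalar chain funpow.simps comp_apply)
           (simp add: scalar_def mult.commute)
      then show ?case
        by (simp only: Suc pderiv_scalar funpow.simps comp_apply)
    qed
    then have eq: "scalar (c ^ k) * \<rho> g = scalar c * g"
      by (simp add: g_def)
    have "g = [:v:] + [:u:] * var_y"
      by (simp add: g var_y_def)
    then have "\<rho> g = [:pcompose v r:] + [:pcompose u r:] * [:p, [:c:]:]"
      by (simp only: automorphismsD[OF aut] automorphism_const[OF aut r(1)] P)
    \<comment> \<open>This is the coefficient of y^0 in \<open>eq\<close>.\<close>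
    with eq have "smult (c ^ k) (pcompose v r + pcompose u r * p) = smult c v"
      by (simp add: g(1) scalar_def mult.commute)
    then have "degree (pcompose v r + pcompose u r * p) = degree v"
      using c(1) by (metis degree_smult_eq power_not_zero)
    \<comment> \<open>Since \<open>r\<close> has degree 1, v(r) has the same degree as v. This
      isolates u(r) p, and u(r) is nonzero, so the degree of \<open>p\<close> is bounded in terms of
      \<open>b\<close> alone.\<close>
    then have "degree (pcompose v r + pcompose u r * p - pcompose v r) \<le> degree v"
      by (intro degree_diff_le) (simp_all add: degree_pcompose r(2))
    then have "degree (pcompose u r * p) \<le> degree v"
      by simp
    moreover have "pcompose u r \<noteq> 0"
      using g(2) r(2) by (simp add: pcompose_eq_0_iff)
    ultimately have "degree p \<le> degree v"
      by (cases "p = 0") (simp_all add: degree_mult_eq)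
    then show ?thesis
      using total_degree_const[of r] total_degree_linear[of p c] r P
      by (auto simp: aut_degree_def)
  qed
  then show ?thesis
    by (intro exI[of _ "max 1 (degree v)"]) (auto simp: automorphisms_upto_def isotropy_def)
qed

section \<open>Eigenvectors with null eigenvalue and the theorem\<close>

lemma conjugate_mult_pderiv_iff:
  fixes D :: "'a::field_char_0 poly poly \<Rightarrow> 'a poly poly"
  assumes "derivation D" and "D \<noteq> (\<lambda>_. 0)"
  shows "(\<exists>f. eigenvector D f 0 \<and> (\<exists>g\<in>polys_in_x. equivalent_polys f g)) \<longleftrightarrow>
    (\<exists>b. b \<noteq> 0 \<and> conjugate D (\<lambda>f. b * pderiv f))"
proof
  assume "\<exists>f. eigenvector D f 0 \<and> (\<exists>g\<in>polys_in_x. equivalent_polys f g)"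
  then obtain p \<phi> where \<phi>: "\<phi> \<in> automorphisms" and f: "eigenvector D (\<phi> [:p:]) 0"
    by (auto simp: equivalent_polys_def polys_in_x_def)
  obtain \<psi> where \<psi>: "\<psi> \<in> automorphisms" "\<phi> \<circ> \<psi> = id" "\<psi> \<circ> \<phi> = id"
    using automorphism_inverse[OF \<phi>] by metis
  have inv: "\<phi> (\<psi> f) = f" "\<psi> (\<phi> f) = f" for f
    using \<psi> by (simp_all add: fun_eq_iff)
  define E where "E = \<psi> \<circ> D \<circ> \<phi>"
  have der: "derivation E"
    unfolding E_def by (rule derivation_conj[OF \<psi>(1) \<phi> inv(2) assms(1)])
  \<comment> \<open>A constant \<open>p\<close> would make the eigenvector a scalar. With
    characteristic zero, p' is then nonzero and can be cancelled from p' E(x) = 0.\<close>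
  have "degree p \<noteq> 0"
  proof
    assume "degree p = 0"
    then obtain c where "p = [:c:]"
      by (meson degree_eq_zeroE)
    then have "\<phi> [:p:] = scalar c"
      using automorphismsD(4)[OF \<phi>, of c] by (simp add: scalar_def)
    then show False
      using f by (simp add: eigenvector_def)
  qed
  moreover have "E [:p:] = 0"
    using f automorphism_0[OF \<psi>(1)] by (simp add: E_def eigenvector_def)
  ultimately have "E var_x = 0"
    using derivation_const[OF der, of p] by (simp add: pderiv_eq_0_iff)
  then have E: "E = (\<lambda>f. E var_y * pderiv f)"
    using derivation_eq_mult_pderiv[OF der] by blast
  have D: "D f = \<phi> (E (\<psi> f))" for f
    by (simp add: E_def inv)
  have "E var_y \<noteq> 0"
  proof
    assume "E var_y = 0"
    then have "E f = 0" for f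
      using fun_cong[OF E, of f] by simp
    then show False
      using assms(2) automorphism_0[OF \<phi>] by (simp add: fun_eq_iff D)
  qed
  moreover have "inv_into UNIV \<psi> = \<phi>"
    using \<psi> inv_unique_comp by blast
  then have "conjugate D (\<lambda>f. E var_y * pderiv f)"
    unfolding conjugate_def E[symmetric] using \<psi>(1) by (auto simp: E_def)
  ultimately show "\<exists>b. b \<noteq> 0 \<and> conjugate D (\<lambda>f. b * pderiv f)"
    by blast
next
  assume "\<exists>b. b \<noteq> 0 \<and> conjugate D (\<lambda>f. b * pderiv f)"
  then obtain b where "conjugate D (\<lambda>f. b * pderiv f)"
    by blast
  then obtain \<phi> \<psi> where conj: "\<phi> \<in> automorphisms" "\<psi> \<in> automorphisms"
    "\<And>f. \<phi> (\<psi> f) = f" "\<And>f. \<psi> (\<phi> f) = f" "D = \<psi> \<circ> (\<lambda>f. b * pderiv f) \<circ> \<phi>"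
    by (rule conjugateE) blast
  \<comment> \<open>The eigenvector is the image of x, which b d/dy kills.\<close>
  have "D (\<psi> var_x) = 0"
    using automorphism_0[OF conj(2)] by (simp add: conj(3,5) var_x_def pderiv_pCons)
  moreover have "\<psi> var_x \<noteq> scalar c" for c
  proof
    assume "\<psi> var_x = scalar c"
    then have "var_x = scalar c"
      by (metis conj(1,3) automorphismsD(4))
    then show False
      by (simp add: var_x_def scalar_def)
  qed
  ultimately have "eigenvector D (\<psi> var_x) 0"
    by (auto simp: eigenvector_def)
  moreover have "var_x \<in> (polys_in_x :: 'a poly poly set)"
    by (auto simp: var_x_def polys_in_x_def)
  ultimately show "\<exists>f. eigenvector D f 0 \<and> (\<exists>g\<in>polys_in_x. equivalent_polys f g)"
    using conj(2) unfolding equivalent_polys_def by blast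
qed

theorem theorem2:
  fixes D :: "'a::{alg_closed_field, field_char_0} poly poly \<Rightarrow> 'a poly poly"
  assumes "derivation D" and "D \<noteq> (\<lambda>_. 0)"
  shows "((\<exists>f. eigenvector D f 0 \<and> (\<exists>g\<in>polys_in_x. equivalent_polys f g)) \<longleftrightarrow>
            (\<exists>b. b \<noteq> 0 \<and> conjugate D (\<lambda>f. b * pderiv f))) \<and>
         (\<forall>b. b \<noteq> 0 \<and> conjugate D (\<lambda>f. b * pderiv f) \<longrightarrow>
            (b \<in> polys_in_x \<longrightarrow> locally_nilpotent D \<and> \<not> algebraic_subgroup (isotropy D)) \<and>
            (degree b \<ge> 1 \<longrightarrow> algebraic_subgroup (isotropy D)))"
proof (intro conjI allI impI; (elim conjE)?)
  show "(\<exists>f. eigenvector D f 0 \<and> (\<exists>g\<in>polys_in_x. equivalent_polys f g)) \<longleftrightarrow>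
      (\<exists>b. b \<noteq> 0 \<and> conjugate D (\<lambda>f. b * pderiv f))"
    by (rule conjugate_mult_pderiv_iff[OF assms])
next
  fix b :: "'a poly poly"
  assume "conjugate D (\<lambda>f. b * pderiv f)"
  then obtain \<phi> \<psi> where conj: "\<phi> \<in> automorphisms" "\<psi> \<in> automorphisms"
    "\<And>f. \<phi> (\<psi> f) = f" "\<And>f. \<psi> (\<phi> f) = f"
    and D': "(\<lambda>f. b * pderiv f) = \<phi> \<circ> D \<circ> \<psi>" and D: "D = \<psi> \<circ> (\<lambda>f. b * pderiv f) \<circ> \<phi>"
    by (rule conjugateE) blast
  show "locally_nilpotent D" if "b \<in> polys_in_x"
    unfolding D
    by (intro locally_nilpotent_conj[OF conj(1-3)] locally_nilpotent_mult_pderiv that)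
  show "\<not> algebraic_subgroup (isotropy D)" if "b \<in> polys_in_x"
  proof
    assume "algebraic_subgroup (isotropy D)"
    then obtain d where "isotropy (\<psi> \<circ> (\<lambda>f. b * pderiv f) \<circ> \<phi>) \<subseteq> automorphisms_upto d"
      unfolding algebraic_subgroup_def D by blast
    \<comment> \<open>With \<phi> and \<psi> exchanged, a degree bound for \<open>D\<close>
      transfers back to b d/dy, which has none.\<close>
    from isotropy_conj_bounded[OF conj(2,1,4,3) this] isotropy_mult_pderiv_unbounded[OF that]
    show False
      by blast
  qed
  show "algebraic_subgroup (isotropy D)" if deg: "degree b \<ge> 1"
  proof -
    obtain d where "isotropy (\<phi> \<circ> D \<circ> \<psi>) \<subseteq> automorphisms_upto d"
      using isotropy_mult_pderiv_bounded[OF deg] by (auto simp: D'[symmetric])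
    from isotropy_conj_bounded[OF conj this] show ?thesis
      unfolding algebraic_subgroup_def
      using subgroup_isotropy closedin_isotropy[OF assms(1)] by blast
  qed
qed

end
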